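(* Let $f_0,f_1,\dots,f_m$ and $g$ be quadratic polynomials on $\mathbb{R}^n$, and let $T=\{x\in\mathbb{R}^n: g(x)\ge 0\}$ be nonempty. Assume that $f_0$ is nonnegative on $T$, that $f_0$ is nonzero at every point of some dense subset of $T$, and that every $f_i/f_0$ is well defined on $T$. Let $$U=\left\{\left(\frac{f_1(x)}{f_0(x)},\dots,\frac{f_m(x)}{f_0(x)}\right): x\in T\right\}\subset\mathbb{R}^m .$$ Let $F_0,\dots,F_m,G$ be the real symmetric $(n+1)\times(n+1)$ matrices representing the homogenizations of $f_0,\dots,f_m,g$. If there exist $\mu_1\in\mathbb{R}$ and $\mu_2\in\mathbb{R}$ with $\mu_2\ge 0$ such that $\mu_1F_0+\mu_2G\prec 0$, then $$\overline{\mathrm{conv}(U)}=\{(F_1\bullet X,\dots,F_m\bullet X): X\succeq 0,\ F_0\bullet X=1,\ G\bullet X\ge 0\},$$ where $X$ ranges over real symmetric $(n+1)\times(n+1)$ matrices.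
   Context: For $x^h=(x_0,x_1,\dots,x_n)$ the homogenizations are $f_i^h(x^h)=x_0^2f_i(x/x_0)$ and $g^h(x^h)=x_0^2g(x/x_0)$ with $x=(x_1,\dots,x_n)$ (extended polynomially to $x_0=0$), and $F_i$, $G$ are the symmetric matrices with $f_i^h(x^h)=(x^h)^TF_i\,x^h$ and $g^h(x^h)=(x^h)^TG\,x^h$. "$f_i/f_0$ is well defined on $T$" means that the limit $\lim_{x\to z}f_i(x)/f_0(x)$ exists whenever $f_0$ vanishes at $z\in T$ (and the quotient at $z$ is understood as this limit). $A\bullet B=\mathrm{trace}(A^TB)$ is the Frobenius inner product; $M\succeq 0$ means positive semidefinite and $M\prec 0$ negative definite for symmetric $M$; $\mathrm{conv}(K)$ is the convex hull and $\overline{K}$ the closure of $K$. *)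

theory Defs
  imports "HOL-Analysis.Analysis"
begin

text \<open>``Quadratic'' means of degree at most two; constant and affine functions are included.\<close>

definition quadratic_polynomial :: "(real^'n \<Rightarrow> real) \<Rightarrow> bool" where
  "quadratic_polynomial f \<longleftrightarrow>
     (\<exists>(A :: real^'n^'n) b c. \<forall>x. f x = x \<bullet> (A *v x) + b \<bullet> x + c)"

text \<open>
  Points \<open>(x\<^sub>0, x\<^sub>1, \<dots>, x\<^sub>n)\<close> of dimension \<open>n + 1\<close> are indexed by \<^typ>\<open>'n option\<close>:
  the index \<^const>\<open>None\<close> carries the homogenizing coordinate \<open>x\<^sub>0\<close>, and \<open>Some i\<close> carries \<open>x\<^sub>i\<close>.
  The formula \<open>x\<^sub>0\<^sup>2 f (x / x\<^sub>0)\<close> fixes the homogenization off the hyperplane \<open>x\<^sub>0 = 0\<close>;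
  being a polynomial function determines it on that hyperplane.
\<close>

definition is_homogenization ::
    "(real^'n \<Rightarrow> real) \<Rightarrow> (real^('n option) \<Rightarrow> real) \<Rightarrow> bool" where
  "is_homogenization f h \<longleftrightarrow>
     real_polynomial_function h \<and>
     (\<forall>z. z $ None \<noteq> 0 \<longrightarrow> h z = (z $ None)\<^sup>2 * f (\<chi> i. z $ Some i / z $ None))"

definition symmetric_matrix :: "real^'k^'k \<Rightarrow> bool" where
  "symmetric_matrix A \<longleftrightarrow> transpose A = A"

definition represents_homogenization ::
    "real^('n option)^('n option) \<Rightarrow> (real^'n \<Rightarrow> real) \<Rightarrow> bool" where
  "represents_homogenization F f \<longleftrightarrow>
     symmetric_matrix F \<and> is_homogenization f (\<lambda>z. z \<bullet> (F *v z))"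

definition frobenius_inner :: "real^'k^'k \<Rightarrow> real^'k^'k \<Rightarrow> real" where
  "frobenius_inner A B = trace (transpose A ** B)"

definition pos_semidef :: "real^'k^'k \<Rightarrow> bool" where
  "pos_semidef M \<longleftrightarrow> symmetric_matrix M \<and> (\<forall>v. 0 \<le> v \<bullet> (M *v v))"

definition neg_def :: "real^'k^'k \<Rightarrow> bool" where
  "neg_def M \<longleftrightarrow> symmetric_matrix M \<and> (\<forall>v. v \<noteq> 0 \<longrightarrow> v \<bullet> (M *v v) < 0)"

text \<open>
  The limit at a zero of \<open>q\<close> is taken along the points of \<open>T\<close> at which the quotient makes sense.
  Restricting to \<open>q x \<noteq> 0\<close> is essential, because division by zero yields zero in HOL.
  The limit is unique at \<open>z \<in> T\<close> as soon as \<open>q\<close> is nonzero on a dense subset of \<open>T\<close>.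
\<close>

definition quotient_well_defined_on ::
    "(real^'n) set \<Rightarrow> (real^'n \<Rightarrow> real) \<Rightarrow> (real^'n \<Rightarrow> real) \<Rightarrow> bool" where
  "quotient_well_defined_on T p q \<longleftrightarrow>
     (\<forall>z\<in>T. q z = 0 \<longrightarrow>
        (\<exists>l. ((\<lambda>x. p x / q x) \<longlongrightarrow> l) (at z within {x \<in> T. q x \<noteq> 0})))"

definition quotient_on ::
    "(real^'n) set \<Rightarrow> (real^'n \<Rightarrow> real) \<Rightarrow> (real^'n \<Rightarrow> real) \<Rightarrow> real^'n \<Rightarrow> real" where
  "quotient_on T p q z =
     (if q z \<noteq> 0 then p z / q z
      else Lim (at z within {x \<in> T. q x \<noteq> 0}) (\<lambda>x. p x / q x))"

end

theory Submission
  imports Defs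
begin

text \<open>
  Write \<open>q\<^sub>A x = x \<bullet> (A *v x)\<close> and let \<open>S\<close> be the slice of homogeneous points \<open>x\<close> with
  \<open>q\<^sub>F\<^sub>0 x = 1\<close> and \<open>q\<^sub>G x \<ge> 0\<close>, mapped to \<open>\<real>\<^sup>m\<close> by \<open>\<phi> x = (q\<^sub>F\<^sub>i x)\<^sub>i\<close>.  Both sides of the
  theorem equal the convex hull of \<open>\<phi> ` S\<close>.

  Two facts about the cone \<open>q\<^sub>G x \<ge> 0\<close> make this work.  First, because \<open>T\<close> is nonempty, every
  point of the cone on the hyperplane at infinity is a limit of cone points with nonzero
  homogenizing coordinate (\<open>approximate_by_finite_points\<close>), so \<open>q\<^sub>F\<^sub>0 \<ge> 0\<close> passes from \<open>T\<close> to
  the whole cone.  Secondly, if \<open>q\<^sub>F\<^sub>0 x = 0\<close> on the cone, then the negative definite form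
  \<open>\<mu>\<^sub>1 F\<^sub>0 + \<mu>\<^sub>2 G\<close> takes the value \<open>\<mu>\<^sub>2 q\<^sub>G x \<ge> 0\<close> at \<open>x\<close>, so \<open>x = 0\<close>.  Hence \<open>q\<^sub>F\<^sub>0 > 0\<close> on
  the cone without the origin; in particular \<open>f\<^sub>0 > 0\<close> on \<open>T\<close>, and \<open>U\<close> consists of ordinary
  quotients.  Normalizing homogeneous points by \<open>q\<^sub>F\<^sub>0 x = 1\<close> gives \<open>U \<subseteq> \<phi> ` S\<close>, and the
  approximation gives \<open>\<phi> ` S \<subseteq> closure U\<close>.  The negative definite combination also bounds
  \<open>S\<close> (\<open>compact_slice\<close>), so the hull of \<open>\<phi> ` S\<close> is closed and equals the closed convex hull
  of \<open>U\<close>.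

  For the semidefinite side, the rank-one matrices built from \<open>S\<close> are feasible.  Conversely
  every feasible \<open>X\<close> is a sum of rank-one matrices \<open>y y\<^sup>T\<close> that all satisfy \<open>q\<^sub>G y \<ge> 0\<close>
  (\<open>pos_semidef_decomposition_nonneg\<close>, the decomposition of Sturm and Zhang).  The numbers
  \<open>q\<^sub>F\<^sub>0 y\<close> are nonnegative with sum \<open>1\<close>, and after discarding zero vectors and rescaling they
  become the weights of a convex combination of points of \<open>\<phi> ` S\<close>.
\<close>

section \<open>Quadratic forms\<close>

lemma frobenius_inner_sum:
  fixes A B :: "real^'k^'k"
  shows "frobenius_inner A B = (\<Sum>i\<in>UNIV. \<Sum>j\<in>UNIV. A $ i $ j * B $ i $ j)"
  unfolding frobenius_inner_def trace_def transpose_def matrix_matrix_mult_def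
  by (simp, subst sum.swap, rule refl)

lemma frobenius_inner_add: "frobenius_inner A (B + C) = frobenius_inner A B + frobenius_inner A C"
  by (simp add: frobenius_inner_sum sum.distrib distrib_left)

lemma frobenius_inner_scaleR: "frobenius_inner A (c *\<^sub>R B) = c * frobenius_inner A B"
  by (simp add: frobenius_inner_sum sum_distrib_left mult.left_commute)

lemma quadratic_form_sum:
  fixes A :: "real^'k^'k"
  shows "x \<bullet> (A *v x) = (\<Sum>i\<in>UNIV. \<Sum>j\<in>UNIV. A $ i $ j * (x $ i * x $ j))"
  by (simp add: inner_vec_def matrix_vector_mult_def sum_distrib_left mult_ac)

lemma frobenius_inner_rank_one_sum:
  fixes A X :: "real^'k^'k"
  assumes "\<And>i j. X $ i $ j = (\<Sum>k\<in>S. w k $ i * w k $ j)"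
  shows "frobenius_inner A X = (\<Sum>k\<in>S. w k \<bullet> (A *v w k))"
proof -
  have "frobenius_inner A X = (\<Sum>i\<in>UNIV. \<Sum>k\<in>S. \<Sum>j\<in>UNIV. A $ i $ j * (w k $ i * w k $ j))"
    unfolding frobenius_inner_sum assms sum_distrib_left
    by (intro sum.cong refl sum.swap)
  also have "\<dots> = (\<Sum>k\<in>S. w k \<bullet> (A *v w k))"
    unfolding quadratic_form_sum by (rule sum.swap)
  finally show ?thesis .
qed

lemma inner_symmetric_matrix:
  fixes A :: "real^'k^'k"
  assumes "symmetric_matrix A"
  shows "x \<bullet> (A *v y) = y \<bullet> (A *v x)"
  using assms unfolding symmetric_matrix_def
  by (metis dot_lmul_matrix inner_commute transpose_matrix_vector)

lemma quadratic_form_add: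
  fixes A :: "real^'k^'k"
  assumes "symmetric_matrix A"
  shows "(x + t *\<^sub>R y) \<bullet> (A *v (x + t *\<^sub>R y))
         = x \<bullet> (A *v x) + 2 * t * (y \<bullet> (A *v x)) + t\<^sup>2 * (y \<bullet> (A *v y))"
  using inner_symmetric_matrix[OF assms, of x y]
  by (simp add: matrix_vector_right_distrib matrix_vector_mult_scaleR inner_add_left
      inner_add_right power2_eq_square algebra_simps)

lemma quadratic_form_scaleR:
  fixes A :: "real^'k^'k"
  shows "(c *\<^sub>R x) \<bullet> (A *v (c *\<^sub>R x)) = c\<^sup>2 * (x \<bullet> (A *v x))"
  by (simp add: matrix_vector_mult_scaleR power2_eq_square)

lemma quadratic_form_add_axis:
  fixes X :: "real^'k^'k"
  assumes "symmetric_matrix X"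
  shows "(v + t *\<^sub>R axis k 1) \<bullet> (X *v (v + t *\<^sub>R axis k 1))
         = v \<bullet> (X *v v) + 2 * t * (X $ k \<bullet> v) + t\<^sup>2 * X $ k $ k"
  using quadratic_form_add[OF assms, of v t "axis k 1"]
  by (simp add: inner_axis' matrix_vector_mult_basis column_def matrix_vector_mul_component)

lemma tendsto_quadratic_form:
  fixes A :: "real^'k^'k"
  assumes "(f \<longlongrightarrow> x) Z"
  shows "((\<lambda>n. f n \<bullet> (A *v f n)) \<longlongrightarrow> x \<bullet> (A *v x)) Z"
  by (intro tendsto_inner assms bounded_linear.tendsto[OF matrix_vector_mul_bounded_linear])

lemma continuous_quadratic_form: "continuous_on S (\<lambda>x. x \<bullet> ((A :: real^'k^'k) *v x))"
  unfolding continuous_on_def by (auto intro!: tendsto_quadratic_form)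

section \<open>Rank-one decompositions of positive semidefinite matrices\<close>

text \<open>
  Cholesky elimination: a positive diagonal entry allows subtracting a rank-one matrix that
  clears its row and column, and a zero diagonal entry forces the row to vanish already.
  The index set \<open>S\<close> shrinks by the cleared row.
\<close>

lemma pos_semidef_rank_one_sum:
  fixes X :: "real^'k^'k"
  assumes "finite S" "pos_semidef X" "\<And>i j. i \<notin> S \<Longrightarrow> X $ i $ j = 0"
  shows "\<exists>w. \<forall>i j. X $ i $ j = (\<Sum>k\<in>S. w k $ i * w k $ j)"
  using assms
proof (induction S arbitrary: X)
  case empty
  then show ?case by simp
next
  case (insert k S)
  have sym: "symmetric_matrix X" and psd: "\<And>v. 0 \<le> v \<bullet> (X *v v)"
    using insert.prems(1) by (auto simp: pos_semidef_def)
  have sym': "X $ i $ j = X $ j $ i" for i j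
    using arg_cong[OF sym[unfolded symmetric_matrix_def], of "\<lambda>A. A $ j $ i"]
    by (simp add: transpose_def)
  have axis_form: "0 \<le> v \<bullet> (X *v v) + 2 * t * (X $ k \<bullet> v) + t\<^sup>2 * X $ k $ k" for v t
    using psd[of "v + t *\<^sub>R axis k 1"] by (simp only: quadratic_form_add_axis[OF sym])
  show ?case
  proof (cases "X $ k $ k = 0")
    case True
    have "X $ k \<bullet> v = 0" for v
    proof (rule ccontr)
      assume nz: "X $ k \<bullet> v \<noteq> 0"
      \<comment> \<open>Along \<open>axis k 1\<close> the form is affine with nonzero slope; the chosen step makes it \<open>-1\<close>.\<close>
      have "0 \<le> v \<bullet> (X *v v) + 2 * (- (v \<bullet> (X *v v) + 1) / (2 * (X $ k \<bullet> v))) * (X $ k \<bullet> v)"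
        using axis_form[of v "- (v \<bullet> (X *v v) + 1) / (2 * (X $ k \<bullet> v))"] True by simp
      with nz show False by (simp add: field_simps)
    qed
    then have "X $ k = 0" by (metis inner_eq_zero_iff)
    with insert.prems(2) have "X $ i $ j = 0" if "i \<notin> S" for i j
      using that by (cases "i = k") auto
    with insert.IH[OF insert.prems(1)]
    obtain w where "\<forall>i j. X $ i $ j = (\<Sum>l\<in>S. w l $ i * w l $ j)" by blast
    then have "\<forall>i j. X $ i $ j = (\<Sum>l\<in>insert k S. (w(k := 0)) l $ i * (w(k := 0)) l $ j)"
      using insert.hyps by (auto intro!: sum.cong)
    then show ?thesis by blast
  next
    case False
    define c where "c = X $ k $ k"
    have "c \<ge> 0"
      using axis_form[of 0 1] by (simp add: c_def)
    with False have c: "c > 0" by (simp add: c_def)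
    \<comment> \<open>The Schur complement: its form at \<open>v\<close> is the minimum of the form of \<open>X\<close> along \<open>v + t *\<^sub>R axis k 1\<close>.\<close>
    define Y :: "real^'k^'k" where "Y = (\<chi> i j. X $ i $ j - X $ k $ i * X $ k $ j / c)"
    have Yform: "v \<bullet> (Y *v v) = v \<bullet> (X *v v) - (X $ k \<bullet> v)\<^sup>2 / c" for v
    proof -
      have "(X $ k \<bullet> v)\<^sup>2 / c = (\<Sum>i\<in>UNIV. \<Sum>j\<in>UNIV. X $ k $ i * X $ k $ j / c * (v $ i * v $ j))"
        unfolding power2_eq_square inner_vec_def sum_product sum_divide_distrib
        by (intro sum.cong refl) simp
      then show ?thesis
        unfolding quadratic_form_sum Y_def by (simp add: left_diff_distrib sum_subtractf)
    qed
    have "pos_semidef Y"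
      unfolding pos_semidef_def
    proof
      show "symmetric_matrix Y"
        unfolding symmetric_matrix_def Y_def transpose_def by (simp add: vec_eq_iff sym' mult.commute)
      show "\<forall>v. 0 \<le> v \<bullet> (Y *v v)"
      proof
        fix v
        have "0 \<le> v \<bullet> (X *v v) + 2 * (- (X $ k \<bullet> v) / c) * (X $ k \<bullet> v) + (- (X $ k \<bullet> v) / c)\<^sup>2 * c"
          using axis_form[of v "- (X $ k \<bullet> v) / c"] by (simp add: c_def)
        also have "\<dots> = v \<bullet> (Y *v v)"
          unfolding Yform using c by (simp add: power2_eq_square field_simps)
        finally show "0 \<le> v \<bullet> (Y *v v)" .
      qed
    qed
    moreover have "Y $ i $ j = 0" if "i \<notin> S" for i j
    proof (cases "i = k")
      case True
      with c show ?thesis by (simp add: Y_def c_def)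
    next
      case False
      with that insert.prems(2)[of i] show ?thesis
        by (simp add: Y_def sym'[of k i])
    qed
    ultimately obtain w where w: "\<forall>i j. Y $ i $ j = (\<Sum>l\<in>S. w l $ i * w l $ j)"
      using insert.IH by blast
    define w' where "w' = w(k := (1 / sqrt c) *\<^sub>R X $ k)"
    have "X $ i $ j = (\<Sum>l\<in>insert k S. w' l $ i * w' l $ j)" for i j
    proof -
      have "(\<Sum>l\<in>S. w' l $ i * w' l $ j) = Y $ i $ j"
        using insert.hyps w by (auto simp: w'_def intro!: sum.cong)
      moreover have "w' k $ i * w' k $ j = X $ k $ i * X $ k $ j / c"
        using c by (simp add: w'_def)
      ultimately show ?thesis
        using insert.hyps by (simp add: Y_def)
    qed
    then show ?thesis by blast
  qed
qed

text \<open>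
  Rotating the pair \<open>(x, y)\<close> by any angle preserves \<open>x x\<^sup>T + y y\<^sup>T\<close>.  On a quarter turn the
  first vector moves from \<open>x\<close> to \<open>y\<close>, so its value under \<open>G\<close> changes sign on the way.
\<close>

lemma rotate_to_isotropic:
  fixes G :: "real^'k^'k"
  assumes "x \<bullet> (G *v x) < 0" "y \<bullet> (G *v y) > 0"
  shows "\<exists>u v. u \<bullet> (G *v u) = 0 \<and>
    (\<forall>M. u \<bullet> (M *v u) + v \<bullet> (M *v v) = x \<bullet> (M *v x) + y \<bullet> (M *v y))"
proof -
  define r where "r t = cos t *\<^sub>R x + sin t *\<^sub>R y" for t
  have "\<exists>t. 0 \<le> t \<and> t \<le> pi / 2 \<and> r t \<bullet> (G *v r t) = 0"
  proof (rule IVT')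
    show "continuous_on {0..pi / 2} (\<lambda>t. r t \<bullet> (G *v r t))"
      unfolding r_def
      by (intro continuous_on_compose2[OF continuous_quadratic_form[of UNIV G]] continuous_intros) auto
  qed (use assms in \<open>auto simp: r_def\<close>)
  then obtain t where t: "r t \<bullet> (G *v r t) = 0" by blast
  define v where "v = (- sin t) *\<^sub>R x + cos t *\<^sub>R y"
  have "r t \<bullet> (M *v r t) + v \<bullet> (M *v v) = x \<bullet> (M *v x) + y \<bullet> (M *v y)" for M :: "real^'k^'k"
  proof -
    define c s where "c = cos t" and "s = sin t"
    have "r t \<bullet> (M *v r t) + v \<bullet> (M *v v)
      = (c\<^sup>2 + s\<^sup>2) * (x \<bullet> (M *v x)) + (c\<^sup>2 + s\<^sup>2) * (y \<bullet> (M *v y))"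
      unfolding r_def v_def c_def[symmetric] s_def[symmetric]
      by (simp add: matrix_vector_right_distrib matrix_vector_mult_scaleR
          matrix_vector_mult_diff_distrib inner_add_left inner_diff_left
          inner_diff_right inner_add_right power2_eq_square algebra_simps)
    then show ?thesis by (simp add: c_def s_def)
  qed
  with t show ?thesis by blast
qed

text \<open>
  Rotate a vector of negative value against one of positive value until the first becomes
  isotropic.  It can then be set aside, since the remaining vectors still have nonnegative
  total; so the induction is on the number of vectors.
\<close>

lemma redistribute_nonneg:
  fixes G :: "real^'k^'k" and x :: "'i \<Rightarrow> real^'k"
  assumes "finite I" "(\<Sum>i\<in>I. x i \<bullet> (G *v x i)) \<ge> 0"
  shows "\<exists>y. (\<forall>i\<in>I. y i \<bullet> (G *v y i) \<ge> 0) \<and>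
    (\<forall>M. (\<Sum>i\<in>I. y i \<bullet> (M *v y i)) = (\<Sum>i\<in>I. x i \<bullet> (M *v x i)))"
  using assms
proof (induction "card I" arbitrary: I x)
  case 0
  then show ?case by auto
next
  case (Suc n)
  show ?case
  proof (cases "\<forall>i\<in>I. x i \<bullet> (G *v x i) \<ge> 0")
    case True
    then show ?thesis by blast
  next
    case False
    then obtain i where i: "i \<in> I" "x i \<bullet> (G *v x i) < 0" by force
    obtain j where j: "j \<in> I" "x j \<bullet> (G *v x j) > 0"
    proof (rule ccontr)
      assume "\<not> thesis"
      then have "\<forall>j\<in>I. x j \<bullet> (G *v x j) \<le> 0" using that by force
      with i Suc.prems have "(\<Sum>i\<in>I. x i \<bullet> (G *v x i)) < (\<Sum>i\<in>I. 0)"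
        by (intro sum_strict_mono_ex1) auto
      with Suc.prems show False by simp
    qed
    have ij: "i \<noteq> j" using i j by auto
    obtain u v where u: "u \<bullet> (G *v u) = 0"
      and uv: "\<And>M. u \<bullet> (M *v u) + v \<bullet> (M *v v) = x i \<bullet> (M *v x i) + x j \<bullet> (M *v x j)"
      using rotate_to_isotropic[OF i(2) j(2)] by blast
    define J where "J = I - {i}"
    define z where "z = x(j := v)"
    have J: "finite J" "j \<in> J" "n = card J" and I: "I = insert i J" "i \<notin> J"
      using Suc i j ij by (auto simp: J_def)
    have total: "u \<bullet> (M *v u) + (\<Sum>l\<in>J. z l \<bullet> (M *v z l)) = (\<Sum>l\<in>I. x l \<bullet> (M *v x l))" for M
    proof -
      have "(\<Sum>l\<in>J. z l \<bullet> (M *v z l)) = v \<bullet> (M *v v) + (\<Sum>l\<in>J - {j}. x l \<bullet> (M *v x l))"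
        using J by (simp add: sum.remove[of J j] z_def)
      moreover have "(\<Sum>l\<in>I. x l \<bullet> (M *v x l))
          = x i \<bullet> (M *v x i) + (x j \<bullet> (M *v x j) + (\<Sum>l\<in>J - {j}. x l \<bullet> (M *v x l)))"
        using J I by (simp add: sum.remove[of J j])
      ultimately show ?thesis using uv[of M] by simp
    qed
    have "(\<Sum>l\<in>J. z l \<bullet> (G *v z l)) \<ge> 0"
      using total[of G] u Suc.prems by simp
    from Suc.hyps(1)[OF J(3,1) this] obtain y
      where y: "\<forall>l\<in>J. y l \<bullet> (G *v y l) \<ge> 0"
        and yz: "\<And>M. (\<Sum>l\<in>J. y l \<bullet> (M *v y l)) = (\<Sum>l\<in>J. z l \<bullet> (M *v z l))"
      by blast
    define y' where "y' = y(i := u)"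
    have "\<forall>l\<in>I. y' l \<bullet> (G *v y' l) \<ge> 0"
      using y u by (auto simp: y'_def I(1))
    moreover have "(\<Sum>l\<in>I. y' l \<bullet> (M *v y' l)) = (\<Sum>l\<in>I. x l \<bullet> (M *v x l))" for M
    proof -
      have "(\<Sum>l\<in>J. y' l \<bullet> (M *v y' l)) = (\<Sum>l\<in>J. y l \<bullet> (M *v y l))"
        using I(2) by (auto simp: y'_def intro!: sum.cong)
      then have "(\<Sum>l\<in>I. y' l \<bullet> (M *v y' l)) = u \<bullet> (M *v u) + (\<Sum>l\<in>J. y l \<bullet> (M *v y l))"
        using I J by (simp add: y'_def)
      then show ?thesis using total[of M] yz[of M] by simp
    qed
    ultimately show ?thesis by blast
  qed
qed

lemma pos_semidef_decomposition_nonneg: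
  fixes G X :: "real^'k^'k"
  assumes "pos_semidef X" "frobenius_inner G X \<ge> 0"
  obtains y :: "'k \<Rightarrow> real^'k"
  where "\<And>k. y k \<bullet> (G *v y k) \<ge> 0" "\<And>M. frobenius_inner M X = (\<Sum>k\<in>UNIV. y k \<bullet> (M *v y k))"
proof -
  obtain w :: "'k \<Rightarrow> real^'k" where w: "\<And>i j. X $ i $ j = (\<Sum>k\<in>UNIV. w k $ i * w k $ j)"
    using pos_semidef_rank_one_sum[OF finite_class.finite_UNIV assms(1)] by auto
  note frob = frobenius_inner_rank_one_sum[where X=X and S=UNIV and w=w, OF w]
  have "(\<Sum>k\<in>UNIV. w k \<bullet> (G *v w k)) \<ge> 0" using assms(2) unfolding frob .
  from redistribute_nonneg[OF finite_class.finite_UNIV this] obtain y :: "'k \<Rightarrow> real^'k"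
    where y: "\<forall>k\<in>UNIV. y k \<bullet> (G *v y k) \<ge> 0"
      and yw: "\<forall>M. (\<Sum>k\<in>UNIV. y k \<bullet> (M *v y k)) = (\<Sum>k\<in>UNIV. w k \<bullet> (M *v w k))" by blast
  show thesis
  proof (rule that)
    show "y k \<bullet> (G *v y k) \<ge> 0" for k using y by blast
    show "frobenius_inner M X = (\<Sum>k\<in>UNIV. y k \<bullet> (M *v y k))" for M
      using frob[of M] yw by metis
  qed
qed

lemma rank_one_pos_semidef:
  fixes x :: "real^'k"
  obtains X :: "real^'k^'k"
  where "pos_semidef X" "\<And>M. frobenius_inner M X = x \<bullet> (M *v x)"
proof
  let ?X = "\<chi> i j. x $ i * x $ j"
  show "frobenius_inner M ?X = x \<bullet> (M *v x)" for M
    unfolding frobenius_inner_sum quadratic_form_sum by simp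
  have "v \<bullet> (?X *v v) = (x \<bullet> v)\<^sup>2" for v
    unfolding quadratic_form_sum unfolding inner_vec_def power2_eq_square sum_product
    by (intro sum.cong refl) (simp add: mult_ac)
  then have "\<forall>v. 0 \<le> v \<bullet> (?X *v v)" by (metis zero_le_power2)
  moreover have "symmetric_matrix ?X"
    unfolding symmetric_matrix_def transpose_def by (simp add: mult.commute)
  ultimately show "pos_semidef ?X"
    unfolding pos_semidef_def by blast
qed

section \<open>The lifted set as a convex hull\<close>

text \<open>
  Positivity of \<open>F0\<close> on the cone excludes summands of \<open>X\<close> with weight zero that would still
  contribute to the other coordinates; such summands are recession directions, and with them
  the left-hand side could be larger than the hull.
\<close>

lemma semidefinite_image_eq_convex_hull:
  fixes F0 G :: "real^'k^'k" and F :: "'m::finite \<Rightarrow> real^'k^'k"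
  assumes pos: "\<And>x. x \<noteq> 0 \<Longrightarrow> x \<bullet> (G *v x) \<ge> 0 \<Longrightarrow> x \<bullet> (F0 *v x) > 0"
  shows "{(\<chi> i. frobenius_inner (F i) X) | X.
       pos_semidef X \<and> frobenius_inner F0 X = 1 \<and> frobenius_inner G X \<ge> 0}
    = convex hull ((\<lambda>x. \<chi> i. x \<bullet> (F i *v x)) ` {x. x \<bullet> (F0 *v x) = 1 \<and> x \<bullet> (G *v x) \<ge> 0})"
    (is "?R = convex hull (?\<phi> ` ?S)")
proof (rule antisym)
  show "?R \<subseteq> convex hull (?\<phi> ` ?S)"
  proof clarify
    fix X
    assume X: "pos_semidef X" "frobenius_inner F0 X = 1" "frobenius_inner G X \<ge> 0"
    obtain y :: "'k \<Rightarrow> real^'k" where yG: "\<And>k. y k \<bullet> (G *v y k) \<ge> 0"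
      and frob: "\<And>M. frobenius_inner M X = (\<Sum>k\<in>UNIV. y k \<bullet> (M *v y k))"
      using pos_semidef_decomposition_nonneg[OF X(1,3)] by blast
    define K where "K = {k. y k \<noteq> 0}"
    have frobK: "frobenius_inner M X = (\<Sum>k\<in>K. y k \<bullet> (M *v y k))" for M
      unfolding frob by (rule sum.mono_neutral_right) (auto simp: K_def)
    define a where "a k = y k \<bullet> (F0 *v y k)" for k
    have a: "a k > 0" if "k \<in> K" for k
      using pos yG that by (simp add: a_def K_def)
    define p where "p k = (1 / sqrt (a k)) *\<^sub>R y k" for k
    have form_p: "p k \<bullet> (M *v p k) = (y k \<bullet> (M *v y k)) / a k" if "k \<in> K" for k M
      using a[OF that] unfolding p_def quadratic_form_scaleR by (simp add: power_divide)
    have "p k \<in> ?S" if "k \<in> K" for k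
      using a[OF that] yG[of k] by (simp add: form_p[OF that] flip: a_def)
    then have "(\<Sum>k\<in>K. a k *\<^sub>R ?\<phi> (p k)) \<in> convex hull (?\<phi> ` ?S)"
      using a X(2) by (intro convex_sum) (auto simp: frobK a_def less_imp_le intro: hull_inc)
    moreover have "(\<Sum>k\<in>K. a k *\<^sub>R ?\<phi> (p k)) = (\<chi> i. frobenius_inner (F i) X)"
      using a by (fastforce simp: vec_eq_iff frobK form_p intro!: sum.cong)
    ultimately show "(\<chi> i. frobenius_inner (F i) X) \<in> convex hull (?\<phi> ` ?S)" by simp
  qed
  show "convex hull (?\<phi> ` ?S) \<subseteq> ?R"
  proof (rule hull_minimal)
    show "?\<phi> ` ?S \<subseteq> ?R"
    proof (rule image_subsetI)
      fix x assume x: "x \<in> ?S"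
      obtain X where "pos_semidef X" "\<And>M. frobenius_inner M X = x \<bullet> (M *v x)"
        using rank_one_pos_semidef[of x] by blast
      with x show "?\<phi> x \<in> ?R"
        by (intro CollectI exI[of _ X]) simp
    qed
    show "convex ?R"
    proof (rule convexI)
      fix x y and u v :: real
      assume uv: "0 \<le> u" "0 \<le> v" "u + v = 1" and "x \<in> ?R" "y \<in> ?R"
      then obtain X Y
        where X: "pos_semidef X" "frobenius_inner F0 X = 1" "frobenius_inner G X \<ge> 0"
          and Y: "pos_semidef Y" "frobenius_inner F0 Y = 1" "frobenius_inner G Y \<ge> 0"
          and xy: "x = (\<chi> i. frobenius_inner (F i) X)" "y = (\<chi> i. frobenius_inner (F i) Y)"
        by blast
      let ?Z = "u *\<^sub>R X + v *\<^sub>R Y"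
      have "pos_semidef ?Z"
        using X(1) Y(1) uv
        by (auto simp: pos_semidef_def symmetric_matrix_def transpose_def vec_eq_iff
            matrix_vector_mult_add_rdistrib scaleR_matrix_vector_assoc[symmetric] inner_add_right)
      with uv X Y show "u *\<^sub>R x + v *\<^sub>R y \<in> ?R"
        unfolding xy by (intro CollectI exI[of _ ?Z]) (simp add: frobenius_inner_add frobenius_inner_scaleR vec_eq_iff)
    qed
  qed
qed

section \<open>The slice of the cone and points at infinity\<close>

text \<open>
  The form attains its maximum on the unit sphere, and homogeneity carries the bound over to
  all vectors.
\<close>

lemma neg_def_bound:
  fixes H :: "real^'k^'k"
  assumes "neg_def H"
  obtains l where "l > 0" "\<And>x. x \<bullet> (H *v x) \<le> - l * (norm x)\<^sup>2"
proof -
  let ?s = "sphere 0 1 :: (real^'k) set"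
  have "axis undefined 1 \<in> ?s" by simp
  then have "?s \<noteq> {}" by blast
  with continuous_attains_sup[OF compact_sphere this continuous_quadratic_form[of ?s H]]
  obtain e where e: "e \<in> ?s" "\<And>x. x \<in> ?s \<Longrightarrow> x \<bullet> (H *v x) \<le> e \<bullet> (H *v e)"
    by blast
  show thesis
  proof
    show "- (e \<bullet> (H *v e)) > 0"
      using assms e(1) by (cases "e = 0") (auto simp: neg_def_def)
    show "x \<bullet> (H *v x) \<le> - (- (e \<bullet> (H *v e))) * (norm x)\<^sup>2" for x
    proof (cases "x = 0")
      case False
      have "(1 / norm x) *\<^sub>R x \<in> ?s" using False by simp
      from e(2)[OF this] have "(1 / norm x)\<^sup>2 * (x \<bullet> (H *v x)) \<le> e \<bullet> (H *v e)"
        by (simp only: quadratic_form_scaleR)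
      then show ?thesis
        using False by (simp add: field_simps power2_eq_square)
    qed simp
  qed
qed

text \<open>
  On the slice the negative definite form is at least \<open>m1\<close>, while it is at most a negative
  multiple of \<open>(norm x)\<^sup>2\<close>.
\<close>

lemma compact_slice:
  fixes F0 G :: "real^'k^'k"
  assumes nd: "neg_def (m1 *\<^sub>R F0 + m2 *\<^sub>R G)" and "m2 \<ge> 0"
  shows "compact {x. x \<bullet> (F0 *v x) = 1 \<and> x \<bullet> (G *v x) \<ge> 0}"
    (is "compact ?S")
proof -
  obtain l where l: "l > 0"
    and bound: "\<And>x. x \<bullet> ((m1 *\<^sub>R F0 + m2 *\<^sub>R G) *v x) \<le> - l * (norm x)\<^sup>2"
    using neg_def_bound[OF nd] by blast
  have "norm x \<le> sqrt (- m1 / l)" if "x \<in> ?S" for x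
  proof -
    have "m1 + m2 * (x \<bullet> (G *v x)) \<le> - l * (norm x)\<^sup>2"
      using bound[of x] that
      by (simp add: matrix_vector_mult_add_rdistrib scaleR_matrix_vector_assoc[symmetric] inner_add_right)
    moreover have "m2 * (x \<bullet> (G *v x)) \<ge> 0" using that \<open>m2 \<ge> 0\<close> by simp
    ultimately have "l * (norm x)\<^sup>2 \<le> - m1" by linarith
    then have "(norm x)\<^sup>2 \<le> - m1 / l" using l by (simp add: field_simps)
    then show ?thesis by (rule real_le_rsqrt)
  qed
  then have "bounded ?S" unfolding bounded_iff by blast
  moreover have "closed ?S"
    by (intro closed_Collect_conj closed_Collect_eq closed_Collect_le
        continuous_quadratic_form continuous_on_const)
  ultimately show ?thesis by (simp add: compact_eq_bounded_closed)
qed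

text \<open>
  A point \<open>x\<close> at infinity is perturbed to \<open>x + t p\<close>, where \<open>p\<close> is a finite point of the cone.
  Its value is \<open>q\<^sub>G x + 2 t (p \<bullet> G x) + t\<^sup>2 q\<^sub>G p\<close>, and only the cross term can be negative;
  since quadratic forms are even, the perturbed point may lie on either side of the
  hyperplane, so the sign of \<open>t\<close> can be chosen to suit.
\<close>

lemma approximate_by_finite_points:
  fixes G :: "real^'k^'k"
  assumes sym: "symmetric_matrix G"
    and p: "p $ k \<noteq> 0" "p \<bullet> (G *v p) \<ge> 0" and x: "x \<bullet> (G *v x) \<ge> 0"
  obtains q where "\<And>n. q n $ k \<noteq> 0" "\<And>n. q n \<bullet> (G *v q n) \<ge> 0" "q \<longlonglongrightarrow> x"
proof (cases "x $ k = 0")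
  case False
  show thesis by (rule that[of "\<lambda>_. x"]) (use False x in auto)
next
  case True
  define s :: real where "s = (if p \<bullet> (G *v x) \<ge> 0 then 1 else -1)"
  define q where "q n = x + (s / real (Suc n)) *\<^sub>R p" for n
  show thesis
  proof
    show "q n $ k \<noteq> 0" for n
      using True p(1) by (simp add: q_def s_def)
    have "s * (p \<bullet> (G *v x)) \<ge> 0" by (simp add: s_def)
    then have "2 * (s / real (Suc n)) * (p \<bullet> (G *v x)) \<ge> 0" for n
      by (simp add: field_simps)
    then show "q n \<bullet> (G *v q n) \<ge> 0" for n
      unfolding q_def quadratic_form_add[OF sym] using x p(2)
      by (intro add_nonneg_nonneg) auto
    have "(\<lambda>n. s / real (Suc n)) \<longlonglongrightarrow> 0"
      by (rule LIMSEQ_Suc[OF lim_const_over_n])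
    then show "q \<longlonglongrightarrow> x"
      using tendsto_add[OF tendsto_const tendsto_scaleR[OF _ tendsto_const]] unfolding q_def by fastforce
  qed
qed

lemma represents_homogenizationD:
  assumes "represents_homogenization F f" "z $ None \<noteq> 0"
  shows "z \<bullet> (F *v z) = (z $ None)\<^sup>2 * f (\<chi> i. z $ Some i / z $ None)"
  using assms by (auto simp: represents_homogenization_def is_homogenization_def)

lemma represents_homogenization_affine:
  fixes x :: "real^'n"
  assumes "represents_homogenization F f"
  shows "(\<chi> j. case j of None \<Rightarrow> 1 | Some i \<Rightarrow> x $ i) \<bullet> (F *v (\<chi> j. case j of None \<Rightarrow> 1 | Some i \<Rightarrow> x $ i)) = f x"
  using represents_homogenizationD[OF assms, of "\<chi> j. case j of None \<Rightarrow> 1 | Some i \<Rightarrow> x $ i"]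
  by simp

section \<open>The closed convex hull of the quotients\<close>

theorem mainTheorem3:
  fixes f0 g :: "real^'n \<Rightarrow> real"
    and f :: "'m::finite \<Rightarrow> real^'n \<Rightarrow> real"
    and F0 G :: "real^('n option)^('n option)"
    and F :: "'m \<Rightarrow> real^('n option)^('n option)"
    and T :: "(real^'n) set"
    and U :: "(real^'m) set"
  assumes "quadratic_polynomial f0"
    and "\<And>i. quadratic_polynomial (f i)"
    and "quadratic_polynomial g"
    and T_def: "T = {x. g x \<ge> 0}"
    and "T \<noteq> {}"
    and "\<forall>x\<in>T. f0 x \<ge> 0"
    and "\<exists>D. D \<subseteq> T \<and> T \<subseteq> closure D \<and> (\<forall>x\<in>D. f0 x \<noteq> 0)"
    and "\<And>i. quotient_well_defined_on T (f i) f0"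
    and U_def: "U = {(\<chi> i. quotient_on T (f i) f0 x) | x. x \<in> T}"
    and "represents_homogenization F0 f0"
    and "\<And>i. represents_homogenization (F i) (f i)"
    and "represents_homogenization G g"
    and "\<exists>\<mu>1 \<mu>2 :: real. \<mu>2 \<ge> 0 \<and> neg_def (\<mu>1 *\<^sub>R F0 + \<mu>2 *\<^sub>R G)"
  shows "closure (convex hull U) =
    {(\<chi> i. frobenius_inner (F i) X) | X.
       pos_semidef X \<and> frobenius_inner F0 X = 1 \<and> frobenius_inner G X \<ge> 0}"
proof -
  let ?hom = "\<lambda>x :: real^'n. (\<chi> j. case j of None \<Rightarrow> 1 | Some i \<Rightarrow> x $ i) :: real^('n option)"
  let ?S = "{x. x \<bullet> (F0 *v x) = 1 \<and> x \<bullet> (G *v x) \<ge> 0}"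
  let ?\<phi> = "\<lambda>x. (\<chi> i. x \<bullet> (F i *v x)) :: real^'m"
  note F0 = \<open>represents_homogenization F0 f0\<close>
    and F = \<open>\<And>i. represents_homogenization (F i) (f i)\<close>
    and G = \<open>represents_homogenization G g\<close>
    and f0_nonneg = \<open>\<forall>x\<in>T. f0 x \<ge> 0\<close>
  obtain m1 m2 where m2: "m2 \<ge> 0" and nd: "neg_def (m1 *\<^sub>R F0 + m2 *\<^sub>R G)"
    using \<open>\<exists>\<mu>1 \<mu>2 :: real. \<mu>2 \<ge> 0 \<and> neg_def (\<mu>1 *\<^sub>R F0 + \<mu>2 *\<^sub>R G)\<close> by blast
  have symG: "symmetric_matrix G"
    using G by (simp add: represents_homogenization_def)
  obtain p where "p \<in> T" using \<open>T \<noteq> {}\<close> by blast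
  then have p: "?hom p $ None \<noteq> 0" "?hom p \<bullet> (G *v ?hom p) \<ge> 0"
    using represents_homogenization_affine[OF G, of p] by (simp_all add: T_def)

  have finite_point: "(\<chi> i. z $ Some i / z $ None) \<in> T"
    if "z $ None \<noteq> 0" "z \<bullet> (G *v z) \<ge> 0" for z
    using represents_homogenizationD[OF G that(1)] that by (simp add: T_def zero_le_mult_iff)

  have pos: "x \<bullet> (F0 *v x) > 0" if "x \<noteq> 0" and xG: "x \<bullet> (G *v x) \<ge> 0" for x
  proof -
    obtain q where q: "\<And>n. q n $ None \<noteq> 0" "\<And>n. q n \<bullet> (G *v q n) \<ge> 0" "q \<longlonglongrightarrow> x"
      using approximate_by_finite_points[OF symG p xG] by blast
    \<comment> \<open>Nonnegativity of \<open>f0\<close> only concerns finite points; continuity extends it to infinity.\<close>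
    have "q n \<bullet> (F0 *v q n) \<ge> 0" for n
      using represents_homogenizationD[OF F0 q(1)] finite_point[OF q(1,2)] f0_nonneg by simp
    then have "x \<bullet> (F0 *v x) \<ge> 0"
      using tendsto_quadratic_form[OF q(3), of F0] by (intro LIMSEQ_le_const) auto
    moreover have "x \<bullet> (F0 *v x) \<noteq> 0"
    proof
      assume "x \<bullet> (F0 *v x) = 0"
      then have "x \<bullet> ((m1 *\<^sub>R F0 + m2 *\<^sub>R G) *v x) = m2 * (x \<bullet> (G *v x))"
        by (simp add: matrix_vector_mult_add_rdistrib scaleR_matrix_vector_assoc[symmetric] inner_add_right)
      moreover have "\<dots> \<ge> 0" using m2 xG by simp
      ultimately show False
        using nd \<open>x \<noteq> 0\<close> unfolding neg_def_def by force
    qed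
    ultimately show ?thesis by simp
  qed

  have f0_pos: "f0 x > 0" if "x \<in> T" for x
  proof -
    have "?hom x \<noteq> 0" by (auto simp: vec_eq_iff split: option.splits intro!: exI[of _ None])
    with that show ?thesis
      using pos[of "?hom x"] represents_homogenization_affine[OF G, of x]
        represents_homogenization_affine[OF F0, of x] by (simp add: T_def)
  qed
  have U: "U = (\<lambda>x. \<chi> i. f i x / f0 x) ` T"
    unfolding U_def quotient_on_def using f0_pos by (fastforce simp: vec_eq_iff)

  have "convex hull (?\<phi> ` ?S) \<subseteq> closure (convex hull U)"
  proof (rule hull_minimal)
    show "convex (closure (convex hull U))" by (simp add: convex_closure)
    have "?\<phi> x \<in> closure U" if x: "x \<in> ?S" for x
    proof -
      obtain q where q: "\<And>n. q n $ None \<noteq> 0" "\<And>n. q n \<bullet> (G *v q n) \<ge> 0" "q \<longlonglongrightarrow> x"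
        using approximate_by_finite_points[OF symG p, of x] x by blast
      define r where "r n = (\<chi> i. (q n \<bullet> (F i *v q n)) / (q n \<bullet> (F0 *v q n)))" for n
      have "r n \<in> U" for n
        unfolding U r_def
        by (rule image_eqI[OF _ finite_point[OF q(1,2)[of n]]])
          (use q(1)[of n] in \<open>simp add: represents_homogenizationD[OF F] represents_homogenizationD[OF F0] vec_eq_iff\<close>)
      moreover have "r \<longlonglongrightarrow> (\<chi> i. (x \<bullet> (F i *v x)) / (x \<bullet> (F0 *v x)))"
        unfolding r_def using x
        by (intro tendsto_vec_lambda tendsto_divide tendsto_quadratic_form q(3)) auto
      ultimately show ?thesis
        unfolding closure_sequential using x by auto
    qed
    then show "?\<phi> ` ?S \<subseteq> closure (convex hull U)"
      using closure_mono[OF hull_subset[of U convex]] by blast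
  qed
  moreover have "closure (convex hull U) \<subseteq> convex hull (?\<phi> ` ?S)"
  proof (rule closure_minimal)
    have "continuous_on ?S ?\<phi>"
      by (intro continuous_on_vec_lambda continuous_quadratic_form)
    then show "closed (convex hull (?\<phi> ` ?S))"
      using compact_slice[OF nd m2]
      by (intro compact_imp_closed compact_convex_hull compact_continuous_image)
    have "U \<subseteq> ?\<phi> ` ?S"
      unfolding U
    proof (rule image_subsetI)
      fix x assume x: "x \<in> T"
      note [simp] = represents_homogenization_affine[OF F0] represents_homogenization_affine[OF F]
        represents_homogenization_affine[OF G]
      have f0: "f0 x > 0" using f0_pos[OF x] .
      \<comment> \<open>Rescaling the homogeneous point puts it on the slice and turns quotients into forms.\<close>
      let ?z = "(1 / sqrt (f0 x)) *\<^sub>R ?hom x"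
      have form: "?z \<bullet> (M *v ?z) = (?hom x \<bullet> (M *v ?hom x)) / f0 x" for M
        unfolding quadratic_form_scaleR using f0 by (simp add: power_divide)
      have "?z \<in> ?S"
        unfolding mem_Collect_eq form using f0 x by (simp add: T_def)
      moreover have "(\<chi> i. f i x / f0 x) = ?\<phi> ?z"
        unfolding form by simp
      ultimately show "(\<chi> i. f i x / f0 x) \<in> ?\<phi> ` ?S" by blast
    qed
    then show "convex hull U \<subseteq> convex hull (?\<phi> ` ?S)" by (rule hull_mono)
  qed
  ultimately show ?thesis
    using semidefinite_image_eq_convex_hull[of G F0 F, OF pos] by blast
qed

end
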